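(* Let $f(x)$, $G(x)$ and $g(x)$ be non-zero polynomials in $\mathbb{Z}[x]$ such that $f(x)$ has degree at least three. Suppose $f(x)$ has one of the following forms: (i) $f(x)=x^{2}(x+1)g(x)$; (ii) $f(x)=x(x+1)G(x)-x-1$; (iii) $f(x)=x(x+1)^{2}g(x)-1$; (iv) $f(x)=x(x+1)\big((x-1)g(x)+2\big)-2x-1$; (v) $f(x)=x(x+1)\big((x+2)g(x)-2\big)-2x-2$; (vi) $f(x)=x(x+1)\big(x(x-1)g(x)+1\big)-x$; (vii) $f(x)=x(x+1)\big((x+2)(x+1)g(x)-1\big)-x-2$. Then for each $n\geq 0$, $S_n$ is a specializable continued fraction, and hence $S_\infty$ is a specializable continued fraction.
   Context: For $f(x)\in\mathbb{Z}[x]$ set $f_0(x)=x$ and $f_{n+1}(x)=f(f_n(x))$. $S_n$ denotes the continued fraction expansion (via the Euclidean algorithm in $\mathbb{Q}[x]$) of the rational function $\prod_{i=0}^{n}(1+1/f_i(x))$, and $S_\infty$ the regular continued fraction expansion of $\prod_{i=0}^{\infty}(1+1/f_i(x))$ viewed as an element of the field $\mathbb{Q}((1/x))$ of formal Laurent series in $1/x$; all partial quotients are polynomials in $\mathbb{Q}[x]$. A continued fraction is called specializable if all of its partial quotients lie in $\mathbb{Z}[x]$. *)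

theory Defs
  imports
    "HOL-Analysis.Infinite_Products"
    "HOL-Computational_Algebra.Computational_Algebra"
    "HOL-Computational_Algebra.Field_as_Ring"
begin

definition poly_iter :: "int poly \<Rightarrow> nat \<Rightarrow> int poly" where
  "poly_iter f n = (pcompose f ^^ n) [:0, 1:]"

abbreviation rat_poly_of_int_poly :: "int poly \<Rightarrow> rat poly" where
  "rat_poly_of_int_poly \<equiv> map_poly rat_of_int"

text \<open>
  A continued fraction, finite or infinite, is given by its partial quotients; the value
  \<open>None\<close> marks the indices past the end of a terminating expansion.
\<close>

type_synonym cfrac = "nat \<Rightarrow> rat poly option"

definition specializable :: "cfrac \<Rightarrow> bool" where
  "specializable c \<longleftrightarrow> ran c \<subseteq> range rat_poly_of_int_poly"

function euclid_quotients :: "rat poly \<Rightarrow> rat poly \<Rightarrow> rat poly list" where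
  "euclid_quotients p q = (if q = 0 then [] else p div q # euclid_quotients q (p mod q))"
  by pat_completeness auto
termination
  by (relation "measure (\<lambda>(p, q). euclidean_size q)") (auto intro: mod_size_less)

declare euclid_quotients.simps [simp del]

definition cfrac_of_fract :: "rat poly fract \<Rightarrow> cfrac" where
  "cfrac_of_fract r =
    (let (p, q) = quot_of_fract r; as = euclid_quotients p q
     in (\<lambda>k. if k < length as then Some (as ! k) else None))"

text \<open>
  The field $\mathbf{Q}((1/x))$ is the type \<open>rat fls\<close> whose variable \<open>fls_X\<close> stands for $1/x$,
  so that $x$ itself is \<open>fls_X_inv\<close>.
\<close>

definition fls_of_poly_inv :: "rat poly \<Rightarrow> rat fls" where
  "fls_of_poly_inv p = poly (map_poly fls_const p) fls_X_inv"

text \<open>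
  The library's \<open>fls_prpart\<close> leaves out the constant term, which does belong to the
  polynomial part in $x$.
\<close>

definition fls_polypart :: "rat fls \<Rightarrow> rat poly" where
  "fls_polypart \<alpha> = fls_prpart \<alpha> + [:fls_nth \<alpha> 0:]"

primrec complete_quotient :: "rat fls \<Rightarrow> nat \<Rightarrow> rat fls option" where
  "complete_quotient \<alpha> 0 = Some \<alpha>"
| "complete_quotient \<alpha> (Suc k) =
    (case complete_quotient \<alpha> k of
       None \<Rightarrow> None
     | Some \<beta> \<Rightarrow>
         (let r = \<beta> - fls_of_poly_inv (fls_polypart \<beta>)
          in if r = 0 then None else Some (1 / r)))"

definition cfrac_of_fls :: "rat fls \<Rightarrow> cfrac" where
  "cfrac_of_fls \<alpha> = (\<lambda>k. map_option fls_polypart (complete_quotient \<alpha> k))"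

definition S_fin :: "int poly \<Rightarrow> nat \<Rightarrow> cfrac" where
  "S_fin f n =
    cfrac_of_fract (\<Prod>i\<le>n. 1 + 1 / to_fract (rat_poly_of_int_poly (poly_iter f i)))"

text \<open>
  The infinite product is taken with respect to the metric of the type \<open>fls\<close>, which is
  the $(1/x)$-adic one.
\<close>

definition S_inf :: "int poly \<Rightarrow> cfrac" where
  "S_inf f =
    cfrac_of_fls (prodinf (\<lambda>i. 1 + 1 / fls_of_poly_inv (rat_poly_of_int_poly (poly_iter f i))))"

end

theory Submission
  imports Defs
begin

text \<open>
  Write $P_n = \prod_{i \le n} (1 + 1/f_i)$ as $A/B = [1; a_1, \dots, a_m]$ with preceding convergent
  $A'/B'$, and let $\delta = A'B - AB' = \pm 1$. The continued fraction of $P_{n+1}$ extends that of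
  $P_n$ by a tail $T$, $P_{n+1} = [1; a_1, \dots, a_m, T]$, where
  $AB \cdot T = \delta f_{n+1} - AB'$. In each of the seven cases $\delta f_{n+1}$ has a known residue
  modulo $AB$ (namely $0$, $AB'$, $-\delta$, $AB' + A'B$, $2AB'$, $A'B$, $AB' - \delta$), so that $T = y + Z$
  with $y$ an integral polynomial and $Z$ one of $-B'/B$, $0$, $-A'/A$, $A'/A$, $B'/B$, $\pm 1/(AB)$.
  Since $A/A'$ and $B/B'$ have the reversed partial quotients of $A/B$, up to adding $1$ to the last
  one, the new partial quotients are again integral. The shape of $f$ is what makes the congruence
  pass from $f_{n+1}$ to $f_{n+2} = f(f_{n+1})$.

  For the infinite product, $\deg f_{n+1} > \deg AB$ says that it agrees with $P_n$ to an order that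
  forces all the partial quotients of $P_n$ to occur at the beginning of its expansion.
\<close>

unbundle fps_syntax

section \<open>Products of continued fraction matrices\<close>

text \<open>
  \<open>cf_mat m a b c d\<close> says that the matrix with rows $(a, b)$ and $(c, d)$ is, up to sign, a product of
  $m$ matrices with rows $(a_i, 1)$ and $(1, 0)$, where $a_i$ is not constant. Then
  $a/c = [a_1; \dots, a_m]$ up to signs of the $a_i$.
\<close>

inductive cf_mat :: "nat \<Rightarrow> int poly \<Rightarrow> int poly \<Rightarrow> int poly \<Rightarrow> int poly \<Rightarrow> bool" where
  gen: "degree a > 0 \<Longrightarrow> cf_mat 1 a 1 1 0"
| mult: "cf_mat m a b c d \<Longrightarrow> cf_mat n a' b' c' d' \<Longrightarrow>
    cf_mat (m + n) (a * a' + b * c') (a * b' + b * d') (c * a' + d * c') (c * b' + d * d')"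
| neg: "cf_mat m a b c d \<Longrightarrow> cf_mat m (- a) (- b) (- c) (- d)"

text \<open>The generators are symmetric and transposition reverses a product, so this reverses the
  list of partial quotients.\<close>

lemma cf_mat_transpose: "cf_mat m a b c d \<Longrightarrow> cf_mat m a c b d"
proof (induction rule: cf_mat.induct)
  case (mult m a b c d n a' b' c' d')
  from cf_mat.mult[OF mult.IH(2,1)] show ?case by (simp add: algebra_simps)
qed (rule cf_mat.intros, assumption)+

text \<open>Conjugation by the diagonal matrix with entries 1 and -1 is multiplicative and turns the
  generator of \<open>a\<close> into the negative of that of \<open>- a\<close>. It serves tails
  with a fractional part of opposite sign.\<close>

lemma cf_mat_conj: "cf_mat m a b c d \<Longrightarrow> cf_mat m a (- b) (- c) d"
proof (induction rule: cf_mat.induct)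
  case (gen a)
  from cf_mat.neg[OF cf_mat.gen[of "- a"]] gen show ?case by simp
next
  case (mult m a b c d n a' b' c' d')
  from cf_mat.mult[OF mult.IH] show ?case by (simp add: algebra_simps)
next
  case (neg m a b c d)
  from cf_mat.neg[OF neg.IH] show ?case by simp
qed

text \<open>Applied to a transpose, this adds $1$ to the last partial quotient of the reversed expansion.\<close>

lemma cf_mat_shear: "cf_mat m a b c d \<Longrightarrow> cf_mat m (a + b) b (c + d) d"
proof (induction rule: cf_mat.induct)
  case (gen a)
  hence "degree (a + 1) > 0" by (subst degree_add_eq_left) auto
  from cf_mat.gen[OF this] show ?case by simp
next
  case (mult m a b c d n a' b' c' d')
  \<comment> \<open>The shear multiplies from the right, so only the right factor changes.\<close>
  from cf_mat.mult[OF mult.hyps(1) mult.IH(2)] show ?case by (simp add: algebra_simps)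
next
  case (neg m a b c d)
  from cf_mat.neg[OF neg.IH] show ?case by (simp add: algebra_simps)
qed

text \<open>Appends the partial quotient \<open>y\<close> and then a block. The identity matrix, an
  empty product and hence no \<open>cf_mat\<close>, is the case of an integral tail.\<close>

lemma cf_mat_step:
  assumes "cf_mat m a b c d" "degree y > 0"
    and "cf_mat n p q r s \<or> n = 0 \<and> p = 1 \<and> q = 0 \<and> r = 0 \<and> s = 1"
  shows "cf_mat (m + (1 + n)) (a * (y * p + r) + b * p) (a * (y * q + s) + b * q)
     (c * (y * p + r) + d * p) (c * (y * q + s) + d * q)"
  using assms(3)
proof
  assume "cf_mat n p q r s"
  from cf_mat.mult[OF assms(1) cf_mat.mult[OF cf_mat.gen[OF assms(2)] this]] show ?thesis by simp
next
  assume "n = 0 \<and> p = 1 \<and> q = 0 \<and> r = 0 \<and> s = 1"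
  with cf_mat.mult[OF assms(1) cf_mat.gen[OF assms(2)]] show ?thesis by simp
qed

lemma cf_mat_det: "cf_mat m a b c d \<Longrightarrow> a * d - b * c \<in> {1, - 1}"
proof (induction rule: cf_mat.induct)
  case (mult m a b c d n a' b' c' d')
  have "(a * a' + b * c') * (c * b' + d * d') - (a * b' + b * d') * (c * a' + d * c')
      = (a * d - b * c) * (a' * d' - b' * c')" by algebra
  with mult.IH show ?case by auto
qed auto

text \<open>A generator preserves the dominance of the first entry of a vector over the second. The
  alternative \<open>q = 0\<close> admits the vector (1, 0), where both degrees are 0.\<close>

lemma cf_mat_degree_vec:
  "cf_mat m a b c d \<Longrightarrow> p \<noteq> 0 \<Longrightarrow> q = 0 \<or> degree q < degree p \<Longrightarrow>
    a * p + b * q \<noteq> 0 \<and> degree (c * p + d * q) < degree (a * p + b * q)"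
proof (induction arbitrary: p q rule: cf_mat.induct)
  case (gen a)
  hence a: "a \<noteq> 0" by auto
  have "degree (a * p + q) = degree (a * p)"
  proof (cases "q = 0")
    case False
    with gen a show ?thesis by (intro degree_add_eq_left) (auto simp: degree_mult_eq)
  qed simp
  with gen a have "degree (a * p + q) > degree p" by (auto simp: degree_mult_eq)
  thus ?case by auto
next
  case (mult m a b c d n a' b' c' d')
  from mult.IH(2)[OF mult.prems]
  have "a * (a' * p + b' * q) + b * (c' * p + d' * q) \<noteq> 0 \<and>
     degree (c * (a' * p + b' * q) + d * (c' * p + d' * q)) < degree (a * (a' * p + b' * q) + b * (c' * p + d' * q))"
    by (intro mult.IH(1)) auto
  thus ?case by (simp add: algebra_simps)
next
  case (neg m a b c d)
  have "degree (- c * p + - d * q) = degree (c * p + d * q)" "degree (- a * p + - b * q) = degree (a * p + b * q)"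
   by (metis (no_types, lifting) degree_minus minus_add_distrib mult_minus_left)+
  moreover have "- a * p + - b * q = - (a * p + b * q)" by simp
  ultimately show ?case using neg.IH[OF neg.prems] by (metis neg_equal_0_iff_equal)
qed

lemma cf_mat_degree:
  assumes "cf_mat m a b c d"
  shows "a \<noteq> 0" "degree c < degree a" "degree b < degree a"
    "degree (a + c) = degree a" "a + c \<noteq> 0" "degree (b + d) < degree a"
proof -
  show "a \<noteq> 0" "degree c < degree a"
    using cf_mat_degree_vec[OF assms, of 1 0] by auto
  show "degree b < degree a"
    using cf_mat_degree_vec[OF cf_mat_transpose[OF assms], of 1 0] by auto
  show *: "degree (a + c) = degree a"
    using \<open>degree c < degree a\<close> by (rule degree_add_eq_left)
  with \<open>degree c < degree a\<close> show "a + c \<noteq> 0" by auto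
  \<comment> \<open>The sheared transpose has the first column \<open>a + c\<close>,
    \<open>b + d\<close>.\<close>
  show "degree (b + d) < degree a"
    using cf_mat_degree_vec[OF cf_mat_shear[OF cf_mat_transpose[OF assms]], of 1 0] * by auto
qed

section \<open>The induction along the iterates\<close>

text \<open>
  In the notation above, $b = B$, $b' = B'$, $b + c = A$ and $b' + c' = A'$: the matrix belongs to
  $1/(P_n - 1) = [a_1; \dots, a_m]$.
\<close>

definition cf_state :: "int poly \<Rightarrow> nat \<Rightarrow> int poly \<Rightarrow> int poly \<Rightarrow> int poly \<Rightarrow> int poly \<Rightarrow> bool" where
  "cf_state f n b b' c c' \<longleftrightarrow>
     (\<exists>m > n. cf_mat m b b' c c') \<and>
     (b + c) * (\<Prod>i\<le>n. poly_iter f i) = b * (\<Prod>i\<le>n. poly_iter f i + 1) \<and>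
     degree ((b + c) * b) < degree (poly_iter f (Suc n))"

lemma poly_iter_0: "poly_iter f 0 = [:0, 1:]"
  by (simp add: poly_iter_def)

lemma poly_iter_Suc: "poly_iter f (Suc n) = pcompose f (poly_iter f n)"
  by (simp add: poly_iter_def)

lemma degree_poly_iter: "degree (poly_iter f n) = degree f ^ n"
  by (induction n) (simp_all add: poly_iter_0 poly_iter_Suc degree_pcompose)

text \<open>P_0 = (x + 1)/x, so A = x + 1, B = x and 1/(P_0 - 1) = [x].\<close>

lemma cf_state_0:
  assumes "degree f \<ge> 3"
  shows "cf_state f 0 [:0, 1:] 1 1 0"
proof -
  have "cf_mat 1 [:0, 1:] 1 1 0" by (rule cf_mat.gen) simp
  moreover have "degree (([:0, 1:] + 1) * [:0, 1 :: int:]) \<le> 2" 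
    by (simp add: one_pCons)
  ultimately show ?thesis using assms unfolding cf_state_def
    by (auto simp: degree_poly_iter poly_iter_0 intro!: exI[of _ 1])
qed

text \<open>Let A1, B1 belong to the new matrix. Then \<open>rel\<close> reads \<delta> p F = A B1,
  and the determinant gives A1 B = \<delta> p (F + 1). Dividing, A1/B1 = (A/B)(1 + 1/F), as the next
  product demands.\<close>

lemma cf_state_step:
  fixes n
  assumes st: "cf_state f n b b' c c'" and f3: "degree f \<ge> 3"
    and X: "cf_mat k p q r s \<or> k = 0 \<and> p = 1 \<and> q = 0 \<and> r = 0 \<and> s = 1"
    and F: "F = poly_iter f (Suc n)"
    and eq: "\<delta> * F = (b + c) * b * y + e" and e: "degree e \<le> degree ((b + c) * b)"
    and \<delta>: "\<delta> = b * c' - b' * c"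
    and rel: "\<delta> * p * F = (b + c) * (b * (y * p + r) + b' * p)"
    and deg_p: "degree p \<le> degree ((b + c) * b)"
  shows "cf_state f (Suc n) (b * (y * p + r) + b' * p) (b * (y * q + s) + b' * q)
     (c * (y * p + r) + c' * p) (c * (y * q + s) + c' * q)"
proof -
  define a where "a = b + c"
  define b1 where "b1 = b * (y * p + r) + b' * p"
  define c1 where "c1 = c * (y * p + r) + c' * p"
  define a1 where "a1 = b1 + c1"
  from st obtain m where m: "m > n" "cf_mat m b b' c c'"
    and P: "a * (\<Prod>i\<le>n. poly_iter f i) = b * (\<Prod>i\<le>n. poly_iter f i + 1)"
    and dg: "degree (a * b) < degree F"
    unfolding cf_state_def a_def F by blast
  have \<delta>1: "\<delta> = 1 \<or> \<delta> = - 1" using cf_mat_det[OF m(2)] \<delta> by auto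
  have ab: "a \<noteq> 0" "b \<noteq> 0" using cf_mat_degree[OF m(2)] by (auto simp: a_def)
  have F0: "F \<noteq> 0" "F + 1 \<noteq> 0" using dg by (auto simp: add_eq_0_iff2)
  have degF1: "degree (F + 1) = degree F" using dg by (intro degree_add_eq_left) auto
  have "degree (\<delta> * F) = degree F" using \<delta>1 by auto
  \<comment> \<open>A constant \<open>y\<close> would push the degree of F down to that of
    AB.\<close>
  have y: "degree y > 0"
  proof (rule ccontr)
    assume "\<not> degree y > 0"
    hence "degree (a * b * y) \<le> degree (a * b)"
      using degree_mult_le[of "a * b" y] by simp
    hence "degree (\<delta> * F) \<le> degree (a * b)"
      using e unfolding eq a_def by (intro degree_add_le) auto
    with dg \<open>degree (\<delta> * F) = degree F\<close> show False by simp
  qed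
  from cf_mat_step[OF m(2) y X]
  have M1: "cf_mat (m + (1 + k)) b1 (b * (y * q + s) + b' * q) c1 (c * (y * q + s) + c' * q)"
    by (simp add: b1_def c1_def)
  have p0: "p \<noteq> 0" using X by (auto dest: cf_mat_degree(1))
  have b1: "b1 \<noteq> 0" "a1 \<noteq> 0" using cf_mat_degree[OF M1] by (auto simp: a1_def)
  have r1: "\<delta> * p * F = a * b1" using rel by (simp add: a_def b1_def)
  have "a1 * b - a * b1 = \<delta> * p"
    unfolding a1_def a_def b1_def c1_def \<delta> by algebra
  with r1 have r2: "\<delta> * p * (F + 1) = a1 * b" by algebra
  \<comment> \<open>Multiplying \<open>r1\<close> and \<open>r2\<close> bounds deg A1 B1 by 2 deg F
    + deg AB < 3 deg F; here deg f \<ge> 3 enters.\<close>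
  have "degree (\<delta> * p * F) + degree (\<delta> * p * (F + 1)) = 2 * degree p + 2 * degree F"
    using \<delta>1 p0 F0 degF1 by (auto simp: degree_mult_eq)
  hence "degree (a1 * b1) + degree (a * b) = 2 * degree p + 2 * degree F"
    unfolding r1 r2 using ab b1 by (simp add: degree_mult_eq)
  hence "degree (a1 * b1) < 3 * degree F" using deg_p dg unfolding a_def by linarith
  also have "\<dots> \<le> degree (poly_iter f (Suc (Suc n)))"
    using f3 by (simp add: degree_poly_iter F)
  finally have d1: "degree (a1 * b1) < degree (poly_iter f (Suc (Suc n)))" .
  have "b * (a1 * (\<Prod>i\<le>Suc n. poly_iter f i)) = (a1 * b) * F * (\<Prod>i\<le>n. poly_iter f i)"
    by (simp add: F algebra_simps)
  also have "\<dots> = b1 * (F + 1) * (a * (\<Prod>i\<le>n. poly_iter f i))"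
    using r1 r2 by algebra
  also have "\<dots> = b * (b1 * (\<Prod>i\<le>Suc n. poly_iter f i + 1))"
    unfolding P by (simp add: F algebra_simps)
  finally have P1: "a1 * (\<Prod>i\<le>Suc n. poly_iter f i) = b1 * (\<Prod>i\<le>Suc n. poly_iter f i + 1)"
    using ab by simp
  from M1 m(1) have "\<exists>m > Suc n. cf_mat m b1 (b * (y * q + s) + b' * q) c1 (c * (y * q + s) + c' * q)"
    by (intro exI[of _ "m + (1 + k)"]) auto
  with P1 d1 show ?thesis unfolding cf_state_def a1_def b1_def c1_def by blast
qed

text \<open>
  Here \<open>e\<close> is the residue of $\delta f_{n+1}$ modulo $AB$, and the matrix with entries \<open>p q r s\<close> belongs
  to the reciprocal $p/r$ of the fractional part $Z = r/p$ of the tail.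
\<close>

lemma cf_state_all:
  fixes e :: "int poly \<Rightarrow> int poly \<Rightarrow> int poly \<Rightarrow> int poly \<Rightarrow> int poly"
  assumes f3: "degree f \<ge> 3"
    and base: "- f = ([:0, 1:] + 1) * [:0, 1:] * z + e [:0, 1:] 1 1 0"
    and e: "\<And>m b b' c c'. cf_mat m b b' c c' \<Longrightarrow> degree (e b b' c c') \<le> degree ((b + c) * b)"
    and step: "\<And>m b b' c c' y F \<delta>. cf_mat m b b' c c' \<Longrightarrow> \<delta> * \<delta> = 1 \<Longrightarrow> \<delta> = b * c' - b' * c \<Longrightarrow>
      \<delta> * F = (b + c) * b * y + e b b' c c' \<Longrightarrow>
      \<exists>k p q r s b1 b1' c1 c1' y1.
        (cf_mat k p q r s \<or> k = 0 \<and> p = 1 \<and> q = 0 \<and> r = 0 \<and> s = 1) \<and>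
        degree p \<le> degree ((b + c) * b) \<and>
        b1 = b * (y * p + r) + b' * p \<and> b1' = b * (y * q + s) + b' * q \<and>
        c1 = c * (y * p + r) + c' * p \<and> c1' = c * (y * q + s) + c' * q \<and>
        \<delta> * p * F = (b + c) * b1 \<and>
        (b1 * c1' - b1' * c1) * pcompose f F = (b1 + c1) * b1 * y1 + e b1 b1' c1 c1'"
  shows "\<exists>b b' c c'. cf_state f n b b' c c'"
proof -
  \<comment> \<open>The induction carries the congruence for the next iterate; its quotient
    \<open>y\<close> becomes the next generator.\<close>
  have "\<exists>b b' c c' y. cf_state f n b b' c c' \<and>
      (b * c' - b' * c) * poly_iter f (Suc n) = (b + c) * b * y + e b b' c c'"
  proof (induction n)
    case 0
    \<comment> \<open>The matrix of P_0 has determinant -1, hence the sign of \<open>f\<close> in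
      \<open>base\<close>.\<close>
    have "poly_iter f (Suc 0) = f" by (simp add: poly_iter_Suc poly_iter_0)
    with cf_state_0[OF f3] base show ?case by force
  next
    case (Suc n)
    then obtain b b' c c' y where st: "cf_state f n b b' c c'"
      and eq: "(b * c' - b' * c) * poly_iter f (Suc n) = (b + c) * b * y + e b b' c c'" by blast
    from st obtain m where m: "cf_mat m b b' c c'" unfolding cf_state_def by blast
    define \<delta> where "\<delta> = b * c' - b' * c"
    have \<delta>: "\<delta> * \<delta> = 1" using cf_mat_det[OF m] unfolding \<delta>_def by auto
    from step[OF m \<delta> \<delta>_def eq[folded \<delta>_def]]
    obtain k p q r s b1 b1' c1 c1' y1 where
      X: "cf_mat k p q r s \<or> k = 0 \<and> p = 1 \<and> q = 0 \<and> r = 0 \<and> s = 1"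
        "degree p \<le> degree ((b + c) * b)"
      and M1: "b1 = b * (y * p + r) + b' * p" "b1' = b * (y * q + s) + b' * q"
        "c1 = c * (y * p + r) + c' * p" "c1' = c * (y * q + s) + c' * q"
      and rel: "\<delta> * p * poly_iter f (Suc n) = (b + c) * b1"
      and eq1: "(b1 * c1' - b1' * c1) * pcompose f (poly_iter f (Suc n)) = (b1 + c1) * b1 * y1 + e b1 b1' c1 c1'"
      by blast
    have "cf_state f (Suc n) b1 b1' c1 c1'"
      unfolding M1 by (rule cf_state_step[OF st f3 X(1) refl eq[folded \<delta>_def] e[OF m] \<delta>_def rel[unfolded M1] X(2)])
    with eq1 show ?case unfolding poly_iter_Suc[of f "Suc n"] by blast
  qed
  thus ?thesis by blast
qed

section \<open>Composition with an iterate, and degree bounds\<close>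

lemma pcompose_X: "pcompose [:0, 1:] F = (F :: int poly)"
  by (simp add: pcompose_pCons)

lemma pcompose_power_int: "pcompose (p ^ n) F = (pcompose p F :: int poly) ^ n"
  by (induction n) (simp_all add: pcompose_mult pcompose_1)

lemma pcompose_numeral: "pcompose (numeral k) F = (numeral k :: int poly)"
  by (simp add: numeral_poly)

lemmas pcompose_simps = pcompose_add pcompose_diff pcompose_mult pcompose_power_int pcompose_X
  pcompose_numeral pcompose_1

text \<open>A and B have equal degree while A' and B' have smaller ones. The bounds serve for the
  residues and the denominators \<open>p\<close> of the families.\<close>

lemma cf_mat_degree_mult_le:
  assumes "cf_mat m b b' c c'"
  shows "degree b \<le> degree ((b + c) * b)" "degree (b + c) \<le> degree ((b + c) * b)"
    "degree ((b + c) * b') \<le> degree ((b + c) * b)" "degree ((b' + c') * b) \<le> degree ((b + c) * b)"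
proof -
  note * = cf_mat_degree[OF assms]
  have d: "degree ((b + c) * b) = degree b + degree b" using * by (simp add: degree_mult_eq)
  show "degree b \<le> degree ((b + c) * b)" "degree (b + c) \<le> degree ((b + c) * b)"
    using * d by simp_all
  have "degree (b + c) + degree b' \<le> degree b + degree b" "degree (b' + c') + degree b \<le> degree b + degree b"
    using * by linarith+
  thus "degree ((b + c) * b') \<le> degree ((b + c) * b)"
    "degree ((b' + c') * b) \<le> degree ((b + c) * b)"
    unfolding d using degree_mult_le order_trans by blast+
qed

section \<open>The seven families\<close>

text \<open>Residue 0: T = y - B'/B, so the block is the reversal with signs changed. Since F =
  \<delta> A B y, B1 = B^2 y and A1 = \<delta> (F + 1), the product F^2 (F + 1) is a multiple of A1
  B1.\<close>

lemma cf_state_form_i: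
  fixes f g :: "int poly"
  defines "x \<equiv> [:0, 1:]"
  assumes f3: "degree f \<ge> 3" and f: "f = x^2 * (x + 1) * g"
  shows "\<exists>b b' c c'. cf_state f n b b' c c'"
proof (rule cf_state_all[where z = "- x * g" and e = "\<lambda>b b' c c'. 0"], goal_cases)
  case 2
  show ?case unfolding f x_def[symmetric] by algebra
next
  case (4 m b b' c c' y F \<delta>)
  note m = 4(1) and \<delta> = 4(2,3) and F = 4(4)
  have X: "cf_mat m b (- c) (- b') c'" by (rule cf_mat_conj[OF cf_mat_transpose[OF m]])
  define b1 where "b1 = b * (y * b + - b') + b' * b"
  define b1' where "b1' = b * (y * (- c) + c') + b' * (- c)"
  define c1 where "c1 = c * (y * b + - b') + c' * b"
  define c1' where "c1' = c * (y * (- c) + c') + c' * (- c)"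
  note defs = b1_def b1'_def c1_def c1'_def
  have rel: "\<delta> * b * F = (b + c) * b1" using F unfolding defs by algebra
  have "b1 * c1' - b1' * c1 = - 1" using \<delta> unfolding defs by algebra
  moreover have "b1 = b\<^sup>2 * y" unfolding defs by algebra
  moreover have "b1 + c1 = \<delta> * (F + 1)" using F \<delta>(2) unfolding defs by algebra
  moreover have "pcompose f F = F\<^sup>2 * (F + 1) * pcompose g F"
    unfolding f x_def pcompose_simps by (simp add: algebra_simps power2_eq_square)
  moreover have "F\<^sup>2 = ((b + c) * b * y)\<^sup>2" using F \<delta>(1) by algebra
  ultimately have "(b1 * c1' - b1' * c1) * pcompose f F =
      (b1 + c1) * b1 * (- \<delta> * (b + c)\<^sup>2 * y * pcompose g F) + 0"
    using \<delta>(1) by algebra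
  with X rel cf_mat_degree_mult_le(1)[OF m] show ?case using defs by blast
qed (use f3 in auto)

text \<open>Residue A B': T = y is integral and B1' = B. As \<delta> F = A B1 and \<delta> (F + 1) =
  A1 B, A1 B1 divides F (F + 1), and the new determinant - \<delta> turns - (F + 1) into A1
  B1'.\<close>

lemma cf_state_form_ii:
  fixes f G :: "int poly"
  defines "x \<equiv> [:0, 1:]"
  assumes f3: "degree f \<ge> 3" and f: "f = x * (x + 1) * G - x - 1"
  shows "\<exists>b b' c c'. cf_state f n b b' c c'"
proof (rule cf_state_all[where z = "- G" and e = "\<lambda>b b' c c'. (b + c) * b'"], goal_cases)
  case 2
  show ?case unfolding f x_def[symmetric] by algebra
next
  case (4 m b b' c c' y F \<delta>)
  note m = 4(1) and \<delta> = 4(2,3) and F = 4(4)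
  define b1 where "b1 = b * (y * 1 + 0) + b' * 1"
  define b1' where "b1' = b * (y * 0 + 1) + b' * 0"
  define c1 where "c1 = c * (y * 1 + 0) + c' * 1"
  define c1' where "c1' = c * (y * 0 + 1) + c' * 0"
  note defs = b1_def b1'_def c1_def c1'_def
  have rel: "\<delta> * 1 * F = (b + c) * b1" using F unfolding defs by algebra
  have "b1 * c1' - b1' * c1 = - \<delta>" using \<delta>(2) unfolding defs by algebra
  moreover have "b1' = b" by (simp add: defs)
  moreover have "\<delta> * (F + 1) = (b1 + c1) * b" using F \<delta>(2) unfolding defs by algebra
  moreover have "pcompose f F = F * (F + 1) * pcompose G F - F - 1"
    unfolding f x_def pcompose_simps by (simp add: algebra_simps power2_eq_square)
  ultimately have "(b1 * c1' - b1' * c1) * pcompose f F =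
      (b1 + c1) * b1 * (- \<delta> * (b + c) * b * pcompose G F) + (b1 + c1) * b1'"
    using \<delta>(1) rel by algebra
  moreover have "degree 1 \<le> degree ((b + c) * b)" by simp
  ultimately show ?case using rel defs by blast
qed (use f3 cf_mat_degree_mult_le in auto)

text \<open>Residue - \<delta>: since A' B = A B' + \<delta>, T = y - A'/A. Now B1 = \<delta> F, A1
  = A^2 y and (F + 1)^2 = (A B y)^2, so F (F + 1)^2 is a multiple of A1 B1.\<close>

lemma cf_state_form_iii:
  fixes f g :: "int poly"
  defines "x \<equiv> [:0, 1:]"
  assumes f3: "degree f \<ge> 3" and f: "f = x * (x + 1)^2 * g - 1"
  shows "\<exists>b b' c c'. cf_state f n b b' c c'"
proof (rule cf_state_all[where z = "- (x + 1) * g" and e = "\<lambda>b b' c c'. b' * c - b * c'"], goal_cases)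
  case 2
  show ?case unfolding f x_def[symmetric] by algebra
next
  case (3 m b b' c c')
  from cf_mat_det[OF this] have "b' * c - b * c' = 1 \<or> b' * c - b * c' = - 1"
    by (auto simp: algebra_simps)
  thus ?case by auto
next
  case (4 m b b' c c' y F \<delta>)
  note m = 4(1) and \<delta> = 4(2,3) and F = 4(4)
  have X: "cf_mat m (b + c) (- c) (- (b' + c')) c'"
    by (rule cf_mat_conj[OF cf_mat_shear[OF cf_mat_transpose[OF m]]])
  define b1 where "b1 = b * (y * (b + c) + - (b' + c')) + b' * (b + c)"
  define b1' where "b1' = b * (y * (- c) + c') + b' * (- c)"
  define c1 where "c1 = c * (y * (b + c) + - (b' + c')) + c' * (b + c)"
  define c1' where "c1' = c * (y * (- c) + c') + c' * (- c)"
  note defs = b1_def b1'_def c1_def c1'_def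
  have rel: "\<delta> * (b + c) * F = (b + c) * b1" using F unfolding defs by algebra
  have d: "b1 * c1' - b1' * c1 = - 1" using \<delta> unfolding defs by algebra
  moreover have "b1' * c1 - b1 * c1' = 1" using d by algebra
  moreover have "b1 = \<delta> * F" using F \<delta>(2) unfolding defs by algebra
  moreover have "b1 + c1 = (b + c)\<^sup>2 * y" unfolding defs by algebra
  moreover have "pcompose f F = F * (F + 1)\<^sup>2 * pcompose g F - 1"
    unfolding f x_def pcompose_simps by (simp add: algebra_simps power2_eq_square)
  moreover have "(F + 1)\<^sup>2 = ((b + c) * b * y)\<^sup>2" using F \<delta> by algebra
  ultimately have "(b1 * c1' - b1' * c1) * pcompose f F =
      (b1 + c1) * b1 * (- \<delta> * b\<^sup>2 * y * pcompose g F) + (b1' * c1 - b1 * c1')"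
    using \<delta>(1) by algebra
  with X rel cf_mat_degree_mult_le(2)[OF m] show ?case using defs by blast
qed (use f3 in auto)

text \<open>Residue A B' + A' B: T = y + A'/A and B1 = \<delta> F. From \<delta> (F + 1) = B (A y +
  2 A') and \<delta> (F - 1) = A (B y + 2 B'), F^2 - 1 is a multiple of A1 = A (A y + 2 A').\<close>

lemma cf_state_form_iv:
  fixes f g :: "int poly"
  defines "x \<equiv> [:0, 1:]"
  assumes f3: "degree f \<ge> 3" and f: "f = x * (x + 1) * ((x - 1) * g + 2) - 2 * x - 1"
  shows "\<exists>b b' c c'. cf_state f n b b' c c'"
proof (rule cf_state_all[where z = "- ((x - 1) * g + 2)"
      and e = "\<lambda>b b' c c'. (b + c) * b' + (b' + c') * b"], goal_cases)
  case 2
  show ?case unfolding f x_def[symmetric] by algebra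
next
  case (3 m b b' c c')
  from cf_mat_degree_mult_le[OF this] show ?case by (intro degree_add_le)
next
  case (4 m b b' c c' y F \<delta>)
  note m = 4(1) and \<delta> = 4(2,3) and F = 4(4)
  have X: "cf_mat m (b + c) c (b' + c') c'"
    by (rule cf_mat_shear[OF cf_mat_transpose[OF m]])
  define b1 where "b1 = b * (y * (b + c) + (b' + c')) + b' * (b + c)"
  define b1' where "b1' = b * (y * c + c') + b' * c"
  define c1 where "c1 = c * (y * (b + c) + (b' + c')) + c' * (b + c)"
  define c1' where "c1' = c * (y * c + c') + c' * c"
  note defs = b1_def b1'_def c1_def c1'_def
  have rel: "\<delta> * (b + c) * F = (b + c) * b1" using F unfolding defs by algebra
  have "b1 * c1' - b1' * c1 = - 1" using \<delta> unfolding defs by algebra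
  moreover have "b1 = \<delta> * F" using F unfolding defs by algebra
  \<comment> \<open>Before the shear the matrix is symmetric, being a generator between a matrix and
    its transpose; after it, this reads A1' = A1 - B1.\<close>
  moreover have "b1 + (b1' + c1') = b1 + c1" unfolding defs by algebra
  moreover have "pcompose f F = F * (F\<^sup>2 - 1) * pcompose g F + 2 * F * (F + 1) - 2 * F - 1"
    unfolding f x_def pcompose_simps by (simp add: algebra_simps power2_eq_square)
  moreover have "F\<^sup>2 - 1 = (b1 + c1) * b * (b * y + 2 * b')" using F \<delta> unfolding defs by algebra
  ultimately have "(b1 * c1' - b1' * c1) * pcompose f F =
      (b1 + c1) * b1 * (- \<delta> * b * (b * y + 2 * b') * pcompose g F - 2)
        + ((b1 + c1) * b1' + (b1' + c1') * b1)"
    using \<delta>(1) by algebra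
  with X rel cf_mat_degree_mult_le(2)[OF m] show ?case using defs by blast
qed (use f3 in auto)

text \<open>Residue 2 A B': T = y + B'/B and A1 = \<delta> (F + 1). From \<delta> F = A (B y + 2 B')
  and \<delta> (F + 2) = B (A y + 2 A'), F (F + 2) is a multiple of B1 = B (B y + 2 B').\<close>

lemma cf_state_form_v:
  fixes f g :: "int poly"
  defines "x \<equiv> [:0, 1:]"
  assumes f3: "degree f \<ge> 3" and f: "f = x * (x + 1) * ((x + 2) * g - 2) - 2 * x - 2"
  shows "\<exists>b b' c c'. cf_state f n b b' c c'"
proof (rule cf_state_all[where z = "- ((x + 2) * g - 2)"
      and e = "\<lambda>b b' c c'. (b + c) * b' + (b + c) * b'"], goal_cases)
  case 2
  show ?case unfolding f x_def[symmetric] by algebra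
next
  case (3 m b b' c c')
  from cf_mat_degree_mult_le[OF this] show ?case by (intro degree_add_le)
next
  case (4 m b b' c c' y F \<delta>)
  note m = 4(1) and \<delta> = 4(2,3) and F = 4(4)
  have X: "cf_mat m b c b' c'" by (rule cf_mat_transpose[OF m])
  define b1 where "b1 = b * (y * b + b') + b' * b"
  define b1' where "b1' = b * (y * c + c') + b' * c"
  define c1 where "c1 = c * (y * b + b') + c' * b"
  define c1' where "c1' = c * (y * c + c') + c' * c"
  note defs = b1_def b1'_def c1_def c1'_def
  have rel: "\<delta> * b * F = (b + c) * b1" using F unfolding defs by algebra
  have "b1 * c1' - b1' * c1 = - 1" using \<delta> unfolding defs by algebra
  moreover have "b1 + c1 = \<delta> * (F + 1)" using F \<delta>(2) unfolding defs by algebra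
  \<comment> \<open>The new list of partial quotients is a palindrome, so its matrix is
    symmetric.\<close>
  moreover have "b1' = c1" unfolding defs by algebra
  moreover have "pcompose f F = F * (F + 2) * (F + 1) * pcompose g F - 2 * F * (F + 1) - 2 * F - 2"
    unfolding f x_def pcompose_simps by (simp add: algebra_simps power2_eq_square)
  moreover have "F * (F + 2) = b1 * (b + c) * ((b + c) * y + 2 * (b' + c'))" using F \<delta> unfolding defs by algebra
  ultimately have "(b1 * c1' - b1' * c1) * pcompose f F =
      (b1 + c1) * b1 * (- \<delta> * (b + c) * ((b + c) * y + 2 * (b' + c')) * pcompose g F + 2)
        + ((b1 + c1) * b1' + (b1 + c1) * b1')"
    using \<delta>(1) by algebra
  with X rel cf_mat_degree_mult_le(1)[OF m] show ?case using defs by blast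
qed (use f3 in auto)

text \<open>Residue A' B: T = y + \<delta>/(A B), so the block is the single quotient \<delta> A B,
  with B1 = B F and A1 = A (F + 1). From \<delta> F = B (A y + A') and \<delta> (F - 1) = A (B y +
  B'), AB divides F (F - 1).\<close>

lemma cf_state_form_vi:
  fixes f g :: "int poly"
  defines "x \<equiv> [:0, 1:]"
  assumes f3: "degree f \<ge> 3" and f: "f = x * (x + 1) * (x * (x - 1) * g + 1) - x"
  shows "\<exists>b b' c c'. cf_state f n b b' c c'"
proof (rule cf_state_all[where z = "- (x * (x - 1) * g + 1)"
      and e = "\<lambda>b b' c c'. (b' + c') * b"], goal_cases)
  case 2
  show ?case unfolding f x_def[symmetric] by algebra
next
  case (4 m b b' c c' y F \<delta>)
  note m = 4(1) and \<delta> = 4(2,3) and F = 4(4)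
  have deg: "degree (\<delta> * ((b + c) * b)) = degree ((b + c) * b)"
    using cf_mat_det[OF m] \<delta>(2) by auto
  have X: "cf_mat 1 (\<delta> * ((b + c) * b)) 1 1 0"
    using cf_mat_degree_mult_le(1)[OF m] cf_mat_degree(2)[OF m] by (intro cf_mat.gen) (simp only: deg)
  let ?p = "\<delta> * ((b + c) * b)"
  define b1 where "b1 = b * (y * ?p + 1) + b' * ?p"
  define b1' where "b1' = b * (y * 1 + 0) + b' * 1"
  define c1 where "c1 = c * (y * ?p + 1) + c' * ?p"
  define c1' where "c1' = c * (y * 1 + 0) + c' * 1"
  note defs = b1_def b1'_def c1_def c1'_def
  have b1: "b1 = b * F" using F \<delta> unfolding defs by algebra
  have rel: "\<delta> * ?p * F = (b + c) * b1" using F b1 \<delta>(1) by algebra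
  have d: "b1 * c1' - b1' * c1 = \<delta>" using \<delta>(2) unfolding defs by algebra
  have a1: "b1 + c1 = (b + c) * (F + 1)" using F \<delta> unfolding defs by algebra
  \<comment> \<open>Times F, this makes \<delta> F^2 the new residue A1' B1.\<close>
  have w: "\<delta> * F = (b1' + c1') * b" using F unfolding defs by algebra
  have fF: "pcompose f F = F * (F - 1) * (F * (F + 1) * pcompose g F) + F * F"
    unfolding f x_def pcompose_simps by (simp add: algebra_simps)
  have FF: "F * (F - 1) = (b + c) * b * (((b + c) * y + (b' + c')) * (b * y + b'))" (is "_ = _ * ?u")
    using F \<delta> by algebra
  have "(b1 * c1' - b1' * c1) * pcompose f F = \<delta> * (F * (F - 1)) * (F * (F + 1) * pcompose g F) + \<delta> * F * F"
    unfolding d fF by (simp only: algebra_simps)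
  also have "\<dots> = \<delta> * ((b + c) * b * ?u) * (F * (F + 1) * pcompose g F) + (b1' + c1') * b * F"
    by (simp only: FF w)
  also have "\<dots> = (b1 + c1) * b1 * (\<delta> * ?u * pcompose g F) + (b1' + c1') * b1"
    unfolding a1 unfolding b1 by (simp only: ac_simps)
  finally have "(b1 * c1' - b1' * c1) * pcompose f F =
    (b1 + c1) * b1 * (\<delta> * ?u * pcompose g F) + (b1' + c1') * b1" .
  with X rel deg show ?case using defs by (metis order_refl)
qed (use f3 cf_mat_degree_mult_le in auto)

text \<open>Residue A B' - \<delta>: T = y - \<delta>/(A B), with B1 = - B F and A1 = - A (F + 1).
  From \<delta> (F + 1) = A (B y + B') and \<delta> (F + 2) = B (A y + A'), AB divides (F + 1)(F +
  2).\<close>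

lemma cf_state_form_vii:
  fixes f g :: "int poly"
  defines "x \<equiv> [:0, 1:]"
  assumes f3: "degree f \<ge> 3" and f: "f = x * (x + 1) * ((x + 2) * (x + 1) * g - 1) - x - 2"
  shows "\<exists>b b' c c'. cf_state f n b b' c c'"
proof (rule cf_state_all[where z = "- ((x + 2) * (x + 1) * g - 1)"
      and e = "\<lambda>b b' c c'. (b + c) * b' - (b * c' - b' * c)"], goal_cases)
  case 2
  show ?case unfolding f x_def[symmetric] by algebra
next
  case (3 m b b' c c')
  have "degree (b * c' - b' * c) = 0" using cf_mat_det[OF 3] by auto
  with cf_mat_degree_mult_le[OF 3] show ?case by (intro degree_diff_le[of _ "degree ((b + c) * b)" "b * c' - b' * c"]) auto
next
  case (4 m b b' c c' y F \<delta>)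
  note m = 4(1) and \<delta> = 4(2,3) and F = 4(4)
  have deg: "degree (- \<delta> * ((b + c) * b)) = degree ((b + c) * b)"
    using cf_mat_det[OF m] unfolding \<delta>(2)[symmetric] by auto
  have X: "cf_mat 1 (- \<delta> * ((b + c) * b)) 1 1 0"
    using cf_mat_degree_mult_le(1)[OF m] cf_mat_degree(2)[OF m] by (intro cf_mat.gen) (simp only: deg)
  let ?p = "- \<delta> * ((b + c) * b)"
  define b1 where "b1 = b * (y * ?p + 1) + b' * ?p"
  define b1' where "b1' = b * (y * 1 + 0) + b' * 1"
  define c1 where "c1 = c * (y * ?p + 1) + c' * ?p"
  define c1' where "c1' = c * (y * 1 + 0) + c' * 1"
  note defs = b1_def b1'_def c1_def c1'_def
  have b1: "b1 = - b * F" using F \<delta> unfolding defs by algebra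
  have rel: "\<delta> * ?p * F = (b + c) * b1" using F b1 \<delta>(1) by algebra
  have d: "b1 * c1' - b1' * c1 = \<delta>" using \<delta>(2) unfolding defs by algebra
  have a1: "b1 + c1 = - (b + c) * (F + 1)" using F \<delta> unfolding defs by algebra
  have "(b + c) * b1' = \<delta> * (F + 1)" using F \<delta> unfolding defs by algebra
  hence w: "(b1 + c1) * b1' = - \<delta> * (F + 1) * (F + 1)" using a1 by algebra
  have fF: "pcompose f F = (F + 1) * (F + 2) * (F * (F + 1) * pcompose g F) - (F + 1) * (F + 1) - 1"
    unfolding f x_def pcompose_simps by (simp add: algebra_simps)
  have FF: "(F + 1) * (F + 2) = (b + c) * b * (((b + c) * y + (b' + c')) * (b * y + b'))" (is "_ = _ * ?u")
    using F \<delta> by algebra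
  have "(b1 * c1' - b1' * c1) * pcompose f F =
     \<delta> * ((F + 1) * (F + 2)) * (F * (F + 1) * pcompose g F) + (- \<delta> * (F + 1) * (F + 1) - \<delta>)"
    unfolding d fF by (simp add: algebra_simps)
  also have "\<dots> = \<delta> * ((b + c) * b * ?u) * (F * (F + 1) * pcompose g F)
     + ((b1 + c1) * b1' - (b1 * c1' - b1' * c1))"
    by (simp only: FF w d)
  also have "\<delta> * ((b + c) * b * ?u) * (F * (F + 1) * pcompose g F) = (b1 + c1) * b1 * (\<delta> * ?u * pcompose g F)"
    unfolding a1 unfolding b1 by (simp only: mult_minus_left mult_minus_right minus_minus ac_simps)
  finally have "(b1 * c1' - b1' * c1) * pcompose f F =
    (b1 + c1) * b1 * (\<delta> * ?u * pcompose g F) + ((b1 + c1) * b1' - (b1 * c1' - b1' * c1))" .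
  with X rel deg show ?case using defs by (metis order_refl)
qed (use f3 cf_mat_degree_mult_le in auto)

section \<open>The finite products\<close>

lemma rat_poly_of_int_poly_add: "rat_poly_of_int_poly (p + q) = rat_poly_of_int_poly p + rat_poly_of_int_poly q"
  by (intro poly_eqI) (simp add: coeff_map_poly)

lemma rat_poly_of_int_poly_uminus: "rat_poly_of_int_poly (- p) = - rat_poly_of_int_poly p"
  by (intro poly_eqI) (simp add: coeff_map_poly)

lemma rat_poly_of_int_poly_mult: "rat_poly_of_int_poly (p * q) = rat_poly_of_int_poly p * rat_poly_of_int_poly q"
  by (intro poly_eqI) (simp add: coeff_map_poly coeff_mult)

lemma rat_poly_of_int_poly_prod: "rat_poly_of_int_poly (\<Prod>i\<in>A. p i) = (\<Prod>i\<in>A. rat_poly_of_int_poly (p i))"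
  by (induction A rule: infinite_finite_induct) (simp_all add: rat_poly_of_int_poly_mult)

lemma rat_poly_of_int_poly_eq_0_iff: "rat_poly_of_int_poly p = 0 \<longleftrightarrow> p = 0"
  by (rule map_poly_eq_0_iff) auto

lemma degree_rat_poly_of_int_poly: "degree (rat_poly_of_int_poly p) = degree p"
  by (rule degree_map_poly) auto

lemmas rat_poly_simps = rat_poly_of_int_poly_add rat_poly_of_int_poly_uminus
  rat_poly_of_int_poly_mult rat_poly_of_int_poly_prod rat_poly_of_int_poly_eq_0_iff
  degree_rat_poly_of_int_poly

section \<open>The Euclidean algorithm\<close>

lemma euclid_quotients_0: "euclid_quotients p 0 = []"
  by (subst euclid_quotients.simps) simp

lemma euclid_quotients_nonzero:
  "q \<noteq> 0 \<Longrightarrow> euclid_quotients p q = p div q # euclid_quotients q (p mod q)"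
  by (subst euclid_quotients.simps) simp

text \<open>Allows an unreduced fraction in place of the normalized one from
  \<open>quot_of_fract\<close>, and disposes of a common sign.\<close>

lemma euclid_quotients_mult:
  "d \<noteq> 0 \<Longrightarrow> euclid_quotients (d * p) (d * q) = euclid_quotients p q"
proof (induction p q rule: euclid_quotients.induct)
  case (1 p q)
  show ?case
  proof (cases "q = 0")
    case False
    with 1 have "euclid_quotients (d * q) (d * p mod (d * q)) = euclid_quotients q (p mod q)"
      by (simp add: mod_mult_mult1)
    with False 1(2) show ?thesis
      by (simp add: euclid_quotients_nonzero[of q p] euclid_quotients_nonzero[of "d * q" "d * p"])
  qed (simp add: euclid_quotients_0)
qed

lemma euclid_quotients_step:
  assumes "q \<noteq> 0" "r = 0 \<or> degree r < degree q"
  shows "euclid_quotients (a * q + r) q = a # euclid_quotients q r"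
proof -
  have "r div q = 0" using assms by (auto simp: div_poly_less)
  moreover have "r mod q = r" using assms by (auto simp: mod_poly_less)
  ultimately show ?thesis
    using assms by (simp add: euclid_quotients_nonzero[of q "a * q + r"] poly_div_add_left poly_mod_add_left)
qed

text \<open>By dominance each generator is one division step with its own entry as quotient;
  splitting off all of them leaves the pair \<open>p\<close>, \<open>q\<close>.\<close>

lemma cf_mat_euclid_quotients:
  assumes "cf_mat m a b c d" "p \<noteq> 0" "q = 0 \<or> degree q < degree p"
    and "set (euclid_quotients (rat_poly_of_int_poly p) (rat_poly_of_int_poly q)) \<subseteq> range rat_poly_of_int_poly"
  shows "set (euclid_quotients (rat_poly_of_int_poly (a * p + b * q)) (rat_poly_of_int_poly (c * p + d * q)))
    \<subseteq> range rat_poly_of_int_poly"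
  using assms
proof (induction arbitrary: p q rule: cf_mat.induct)
  case (gen a)
  have "euclid_quotients (rat_poly_of_int_poly a * rat_poly_of_int_poly p + rat_poly_of_int_poly q) (rat_poly_of_int_poly p)
     = rat_poly_of_int_poly a # euclid_quotients (rat_poly_of_int_poly p) (rat_poly_of_int_poly q)"
    using gen by (intro euclid_quotients_step) (auto simp: rat_poly_simps)
  with gen show ?case by (simp add: rat_poly_simps)
next
  case (mult m a b c d n a' b' c' d')
  have "set (euclid_quotients (rat_poly_of_int_poly (a * (a' * p + b' * q) + b * (c' * p + d' * q)))
         (rat_poly_of_int_poly (c * (a' * p + b' * q) + d * (c' * p + d' * q)))) \<subseteq> range rat_poly_of_int_poly"
    using mult.IH(2)[OF mult.prems] cf_mat_degree_vec[OF mult.hyps(2) mult.prems(1,2)]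
    by (intro mult.IH(1)) auto
  thus ?case by (simp add: algebra_simps)
next
  case (neg m a b c d)
  have "rat_poly_of_int_poly (- a * p + - b * q) = - 1 * rat_poly_of_int_poly (a * p + b * q)"
    "rat_poly_of_int_poly (- c * p + - d * q) = - 1 * rat_poly_of_int_poly (c * p + d * q)"
    by (simp_all add: rat_poly_of_int_poly_uminus[symmetric])
  with neg.IH[OF neg.prems] show ?case by (simp only: euclid_quotients_mult)
qed

lemma ran_cfrac_of_fract:
  assumes "q \<noteq> 0"
  shows "ran (cfrac_of_fract (to_fract p / to_fract q)) = set (euclid_quotients p q)"
proof -
  define u v where "u = fst (normalize_quot (p, q))" and "v = snd (normalize_quot (p, q))"
  obtain d where d: "p = u * d" "q = v * d" "d \<noteq> 0"
    unfolding u_def v_def by (rule normalize_quotE[OF assms, of p])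
  have "to_fract p / to_fract q = quot_to_fract (p, q)"
    by (simp add: quot_to_fract_def Fract_conv_to_fract)
  hence "quot_of_fract (to_fract p / to_fract q) = (u, v)"
    by (simp add: quot_of_fract_quot_to_fract u_def v_def)
  moreover have "euclid_quotients u v = euclid_quotients p q"
    using euclid_quotients_mult[OF d(3), of u v] by (simp add: d(1,2) mult.commute)
  ultimately show ?thesis
    by (auto simp: cfrac_of_fract_def ran_def in_set_conv_nth Let_def split: if_splits)
qed

lemma prod_one_plus_inverse:
  fixes u :: "'i \<Rightarrow> 'a :: field"
  assumes "\<And>i. i \<in> I \<Longrightarrow> u i \<noteq> 0" "b \<noteq> 0"
    and "a * (\<Prod>i\<in>I. u i) = b * (\<Prod>i\<in>I. u i + 1)"
  shows "(\<Prod>i\<in>I. 1 + 1 / u i) = a / b"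
proof -
  have "(\<Prod>i\<in>I. 1 + 1 / u i) = (\<Prod>i\<in>I. (u i + 1) / u i)"
    using assms(1) by (intro prod.cong) (auto simp: field_simps)
  also have "\<dots> = (\<Prod>i\<in>I. u i + 1) / (\<Prod>i\<in>I. u i)" by (rule prod_dividef)
  also have "\<dots> = a / b"
  proof (cases "finite I")
    case True
    hence "(\<Prod>i\<in>I. u i) \<noteq> 0" using assms(1) by simp
    with assms show ?thesis by (simp add: field_simps)
  \<comment> \<open>Over an infinite index set all products are 1 by convention, so
    \<open>a = b\<close>.\<close>
  qed (use assms in simp)
  finally show ?thesis .
qed

lemma to_fract_prod: "to_fract (\<Prod>i\<in>A. p i) = (\<Prod>i\<in>A. to_fract (p i))"
  by (induction A rule: infinite_finite_induct) simp_all

lemma specializable_S_fin: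
  assumes st: "cf_state f n b b' c c'" and f: "degree f > 0"
  shows "specializable (S_fin f n)"
proof -
  let ?\<iota> = rat_poly_of_int_poly
  from st obtain m where m: "cf_mat m b b' c c'"
    and P: "(b + c) * (\<Prod>i\<le>n. poly_iter f i) = b * (\<Prod>i\<le>n. poly_iter f i + 1)"
    unfolding cf_state_def by blast
  note deg = cf_mat_degree[OF m]
  have nz: "poly_iter f i \<noteq> 0" for i
    using f degree_poly_iter[of f i] by auto
  have "to_fract (?\<iota> ((b + c) * (\<Prod>i\<le>n. poly_iter f i))) = to_fract (?\<iota> (b * (\<Prod>i\<le>n. poly_iter f i + 1)))"
    by (simp only: P)
  hence "to_fract (?\<iota> (b + c)) * (\<Prod>i\<le>n. to_fract (?\<iota> (poly_iter f i))) =
      to_fract (?\<iota> b) * (\<Prod>i\<le>n. to_fract (?\<iota> (poly_iter f i)) + 1)"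
    by (simp add: rat_poly_simps to_fract_prod)
  hence "(\<Prod>i\<le>n. 1 + 1 / to_fract (?\<iota> (poly_iter f i))) = to_fract (?\<iota> (b + c)) / to_fract (?\<iota> b)"
    using nz deg(1) by (intro prod_one_plus_inverse) (auto simp: rat_poly_simps)
  hence "S_fin f n = cfrac_of_fract (to_fract (?\<iota> (b + c)) / to_fract (?\<iota> b))"
    by (simp only: S_fin_def)
  hence "ran (S_fin f n) = set (euclid_quotients (?\<iota> (b + c)) (?\<iota> b))"
    using deg(1) by (simp only: ran_cfrac_of_fract[of "?\<iota> b"] rat_poly_of_int_poly_eq_0_iff not_False_eq_True)
  \<comment> \<open>The remainder of \<open>b + c\<close> by \<open>b\<close> is \<open>c\<close>,
    of smaller degree.\<close>
  also have "euclid_quotients (?\<iota> (b + c)) (?\<iota> b) = 1 # euclid_quotients (?\<iota> b) (?\<iota> c)"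
    using euclid_quotients_step[of "?\<iota> b" "?\<iota> c" 1] deg(1,2) by (simp add: rat_poly_simps)
  also have "set \<dots> = insert (?\<iota> 1) (set (euclid_quotients (?\<iota> b) (?\<iota> c)))" by simp
  finally have "ran (S_fin f n) = insert (?\<iota> 1) (set (euclid_quotients (?\<iota> b) (?\<iota> c)))" .
  \<comment> \<open>The vector (1, 0) is where the algorithm stops.\<close>
  moreover have "set (euclid_quotients (?\<iota> (b * 1 + b' * 0)) (?\<iota> (c * 1 + c' * 0))) \<subseteq> range ?\<iota>"
    by (rule cf_mat_euclid_quotients[OF m]) (simp_all add: euclid_quotients_0)
  hence "set (euclid_quotients (?\<iota> b) (?\<iota> c)) \<subseteq> range ?\<iota>" by simp
  ultimately show ?thesis unfolding specializable_def by blast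
qed

section \<open>The infinite product\<close>

lemma fls_of_poly_inv_pCons: "fls_of_poly_inv (pCons c p) = fls_const c + fls_X_inv * fls_of_poly_inv p"
proof -
  have "map_poly fls_const (pCons c p) = pCons (fls_const c) (map_poly fls_const p)"
    by (rule map_poly_pCons) simp
  thus ?thesis by (simp only: fls_of_poly_inv_def poly_pCons)
qed

lemma fls_of_poly_inv_nth: "fls_of_poly_inv p $$ k = (if k \<le> 0 then coeff p (nat (- k)) else 0)"
proof (induction p arbitrary: k)
  case 0
  show ?case by (simp add: fls_of_poly_inv_def)
next
  case (pCons c p)
  have *: "fls_of_poly_inv (pCons c p) $$ k = fls_const c $$ k + fls_of_poly_inv p $$ (k + 1)"
    by (simp add: fls_of_poly_inv_pCons fls_X_inv_times_conv_shift)
  consider "k < 0" | "k = 0" | "k > 0" by linarith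
  thus ?case
  proof cases
    case 1
    hence "nat (- k) = Suc (nat (- (k + 1)))" by linarith
    with 1 show ?thesis unfolding * pCons.IH by simp
  next
    case 2
    thus ?thesis unfolding * pCons.IH by simp
  next
    case 3
    thus ?thesis unfolding * pCons.IH by simp
  qed
qed

lemma fls_of_poly_inv_0: "fls_of_poly_inv 0 = 0"
  by (simp add: fls_of_poly_inv_def)

lemma fls_of_poly_inv_1: "fls_of_poly_inv 1 = 1"
  by (simp add: fls_of_poly_inv_def)

lemma fls_of_poly_inv_add: "fls_of_poly_inv (p + q) = fls_of_poly_inv p + fls_of_poly_inv q"
  by (intro fls_eqI) (simp add: fls_of_poly_inv_nth)

lemma fls_of_poly_inv_uminus: "fls_of_poly_inv (- p) = - fls_of_poly_inv p"
  by (intro fls_eqI) (simp add: fls_of_poly_inv_nth)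

lemma fls_of_poly_inv_smult: "fls_of_poly_inv (smult c p) = fls_const c * fls_of_poly_inv p"
  by (intro fls_eqI) (simp add: fls_of_poly_inv_nth)

lemma fls_of_poly_inv_mult: "fls_of_poly_inv (p * q) = fls_of_poly_inv p * fls_of_poly_inv q"
  by (induction p)
     (simp_all add: fls_of_poly_inv_0 fls_of_poly_inv_add fls_of_poly_inv_smult fls_of_poly_inv_pCons algebra_simps)

lemma fls_of_poly_inv_eq_0_iff: "fls_of_poly_inv p = 0 \<longleftrightarrow> p = 0"
proof
  assume *: "fls_of_poly_inv p = 0"
  have "coeff p n = 0" for n
    using fls_of_poly_inv_nth[of p "- int n"] * by simp
  thus "p = 0" by (intro poly_eqI) simp
qed (simp add: fls_of_poly_inv_0)

lemma fls_subdegree_fls_of_poly_inv: "fls_subdegree (fls_of_poly_inv p) = - int (degree p)"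
proof (cases "p = 0")
  case False
  show ?thesis
  proof (rule fls_subdegree_eqI)
    show "fls_of_poly_inv p $$ (- int (degree p)) \<noteq> 0" using False by (simp add: fls_of_poly_inv_nth)
  next
    fix k assume "k < - int (degree p)"
    hence "nat (- k) > degree p" by linarith
    thus "fls_of_poly_inv p $$ k = 0" by (simp add: fls_of_poly_inv_nth coeff_eq_0)
  qed
qed (simp add: fls_of_poly_inv_0)

section \<open>Partial quotients of Laurent series\<close>

lemma fls_polypart_add:
  assumes "fls_subdegree r > 0"
  shows "fls_polypart (fls_of_poly_inv p + r) = p"
proof (rule poly_eqI)
  fix n
  have "r $$ (- int n) = 0" using assms by (intro fls_eq0_below_subdegree) linarith
  moreover from this have "n = 0 \<Longrightarrow> r $$ 0 = 0" by simp
  ultimately show "coeff (fls_polypart (fls_of_poly_inv p + r)) n = coeff p n"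
    by (auto simp: fls_polypart_def fls_of_poly_inv_nth coeff_pCons split: nat.splits simp del: of_nat_Suc)
qed

lemma fls_subdegree_inverse_pos:
  fixes \<tau> :: "'a :: field fls"
  assumes "fls_subdegree \<tau> < 0"
  shows "fls_subdegree (1 / \<tau>) > 0"
proof -
  from assms have "\<tau> \<noteq> 0" by auto
  with assms show ?thesis by (simp add: fls_divide_subdegree)
qed

text \<open>As 1/\<tau> has only negative powers of x, the algorithm removes \<open>p\<close> and
  goes on with \<tau>. The recursion adds steps at the far end, so later steps agree on both
  sides.\<close>

lemma complete_quotient_step:
  assumes "fls_subdegree \<tau> < 0"
  shows "complete_quotient (fls_of_poly_inv p + 1 / \<tau>) (Suc k) = complete_quotient \<tau> k"
proof (induction k)
  case 0
  from assms have "\<tau> \<noteq> 0" by auto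
  thus ?case using fls_polypart_add[OF fls_subdegree_inverse_pos[OF assms], of p] by simp
next
  case (Suc k)
  show ?case
    by (subst complete_quotient.simps(2), subst Suc.IH) simp
qed

text \<open>With \<open>set_option\<close>, an index past the end of a terminating expansion
  satisfies the condition.\<close>

definition specializable_upto :: "nat \<Rightarrow> rat fls \<Rightarrow> bool" where
  "specializable_upto k \<alpha> \<longleftrightarrow> (\<forall>j<k. set_option (cfrac_of_fls \<alpha> j) \<subseteq> range rat_poly_of_int_poly)"

lemma specializable_iff_upto: "specializable (cfrac_of_fls \<alpha>) \<longleftrightarrow> (\<forall>k. specializable_upto k \<alpha>)"
  by (fastforce simp: specializable_def specializable_upto_def ran_def)

lemma specializable_upto_step:
  assumes "fls_subdegree \<tau> < 0" "specializable_upto k \<tau>"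
  shows "specializable_upto (Suc k) (fls_of_poly_inv (rat_poly_of_int_poly a) + 1 / \<tau>)"
proof -
  let ?\<alpha> = "fls_of_poly_inv (rat_poly_of_int_poly a) + 1 / \<tau>"
  have "set_option (cfrac_of_fls ?\<alpha> j) \<subseteq> range rat_poly_of_int_poly" if "j < Suc k" for j
  proof (cases j)
    case 0
    thus ?thesis
      using fls_polypart_add[OF fls_subdegree_inverse_pos[OF assms(1)]] by (simp add: cfrac_of_fls_def)
  next
    case (Suc i)
    have "cfrac_of_fls ?\<alpha> j = cfrac_of_fls \<tau> i"
      unfolding cfrac_of_fls_def Suc complete_quotient_step[OF assms(1)] ..
    with assms(2) that Suc show ?thesis by (simp add: specializable_upto_def)
  qed
  thus ?thesis by (simp add: specializable_upto_def)
qed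

definition fls_of_int_poly :: "int poly \<Rightarrow> rat fls" where
  "fls_of_int_poly p = fls_of_poly_inv (rat_poly_of_int_poly p)"

lemma fls_of_int_poly_simps:
  "fls_of_int_poly 0 = 0" "fls_of_int_poly 1 = 1"
  "fls_of_int_poly (p + q) = fls_of_int_poly p + fls_of_int_poly q"
  "fls_of_int_poly (p - q) = fls_of_int_poly p - fls_of_int_poly q"
  "fls_of_int_poly (- p) = - fls_of_int_poly p"
  "fls_of_int_poly (p * q) = fls_of_int_poly p * fls_of_int_poly q"
proof -
  show *: "fls_of_int_poly (p + q) = fls_of_int_poly p + fls_of_int_poly q"
    "fls_of_int_poly (- p) = - fls_of_int_poly p" for p q
    by (simp_all add: fls_of_int_poly_def rat_poly_simps fls_of_poly_inv_add fls_of_poly_inv_uminus)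
  show "fls_of_int_poly (p - q) = fls_of_int_poly p - fls_of_int_poly q"
    using *(1)[of p "- q"] by (simp add: *)
qed (simp_all add: fls_of_int_poly_def rat_poly_simps fls_of_poly_inv_0 fls_of_poly_inv_1 fls_of_poly_inv_mult)

lemma fls_of_int_poly_prod: "fls_of_int_poly (\<Prod>i\<in>A. p i) = (\<Prod>i\<in>A. fls_of_int_poly (p i))"
  by (induction A rule: infinite_finite_induct) (simp_all add: fls_of_int_poly_simps)

lemma fls_of_int_poly_eq_0_iff: "fls_of_int_poly p = 0 \<longleftrightarrow> p = 0"
  by (simp add: fls_of_int_poly_def fls_of_poly_inv_eq_0_iff rat_poly_simps)

lemma fls_subdegree_fls_of_int_poly: "fls_subdegree (fls_of_int_poly p) = - int (degree p)"
  by (simp add: fls_of_int_poly_def fls_subdegree_fls_of_poly_inv rat_poly_simps)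

text \<open>The quotient of the two \<open>N\<close> terms is the Moebius action of the matrix:
  products act by composition and a common sign cancels. A generator sends \<tau> to a + 1/\<tau>,
  which adds one partial quotient and keeps the order negative.\<close>

lemma cf_mat_specializable_upto:
  assumes "cf_mat m a b c d" "fls_subdegree \<tau> < 0" "specializable_upto k \<tau>"
  defines "N \<equiv> \<lambda>p q \<tau>. fls_of_int_poly p * \<tau> + fls_of_int_poly q"
  shows "N c d \<tau> \<noteq> 0 \<and> fls_subdegree (N a b \<tau> / N c d \<tau>) < 0 \<and>
    specializable_upto (m + k) (N a b \<tau> / N c d \<tau>)"
  using assms(1-3)
proof (induction arbitrary: \<tau> k rule: cf_mat.induct)
  case (gen a)
  from gen have [simp]: "\<tau> \<noteq> 0" by auto
  have *: "N a 1 \<tau> / N 1 0 \<tau> = fls_of_int_poly a + 1 / \<tau>"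
    by (simp add: N_def fls_of_int_poly_simps field_simps)
  have "a \<noteq> 0" using gen by auto
  have "fls_subdegree (fls_of_int_poly a + 1 / \<tau>) = - int (degree a)"
    using fls_subdegree_inverse_pos[OF gen(2)] gen(1) \<open>a \<noteq> 0\<close>
    by (subst fls_subdegree_add_eq1) (auto simp: fls_of_int_poly_eq_0_iff fls_subdegree_fls_of_int_poly)
  with specializable_upto_step[OF gen(2,3), of a] gen(1) show ?case
    unfolding * by (simp add: fls_of_int_poly_def[symmetric]) (simp add: N_def fls_of_int_poly_simps)
next
  case (mult m a b c d n a' b' c' d')
  define \<sigma> where "\<sigma> = N a' b' \<tau> / N c' d' \<tau>"
  have nz: "N c' d' \<tau> \<noteq> 0" and \<sigma>: "fls_subdegree \<sigma> < 0" "specializable_upto (n + k) \<sigma>"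
    using mult.IH(2)[OF mult.prems] by (simp_all add: \<sigma>_def)
  have *: "N (p * a' + q * c') (p * b' + q * d') \<tau> = N p q \<sigma> * N c' d' \<tau>" for p q
  proof -
    have "N p q \<sigma> * N c' d' \<tau> = fls_of_int_poly p * (\<sigma> * N c' d' \<tau>) + fls_of_int_poly q * N c' d' \<tau>"
      by (simp add: N_def algebra_simps)
    also have "\<sigma> * N c' d' \<tau> = N a' b' \<tau>" using nz by (simp add: \<sigma>_def)
    finally show ?thesis by (simp add: N_def fls_of_int_poly_simps algebra_simps)
  qed
  from mult.IH(1)[OF \<sigma>] nz show ?case by (simp add: * add.assoc)
next
  case (neg m a b c d)
  have "N (- p) (- q) \<tau> = - N p q \<tau>" for p q by (simp add: N_def fls_of_int_poly_simps)
  with neg.IH[OF neg.prems] show ?case by simp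
qed

text \<open>A criterion of Legendre type: an approximation beyond order 2 deg B gives the tail
  \<tau> negative order, so \<alpha> = [1; a_1, ..., a_m, \<tau>] is a regular expansion up to
  signs.\<close>

lemma cf_mat_specializable_upto_approx:
  fixes \<alpha> :: "rat fls"
  assumes M: "cf_mat m b b' c c'"
  defines "\<epsilon> \<equiv> \<alpha> - fls_of_int_poly (b + c) / fls_of_int_poly b"
  assumes \<epsilon>: "\<epsilon> \<noteq> 0" "fls_subdegree \<epsilon> > 2 * int (degree b)"
  shows "specializable_upto m \<alpha>"
proof -
  define \<delta> where "\<delta> = b * c' - b' * c"
  let ?\<psi> = fls_of_int_poly
  have "\<delta> = 1 \<or> \<delta> = - 1" using cf_mat_det[OF M] by (simp add: \<delta>_def)
  hence \<delta>: "?\<psi> \<delta> \<noteq> 0" "fls_subdegree (?\<psi> \<delta>) = 0"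
    by (auto simp: fls_of_int_poly_eq_0_iff fls_subdegree_fls_of_int_poly)
  note deg = cf_mat_degree[OF M]
  have b: "?\<psi> b \<noteq> 0" using deg(1) by (simp add: fls_of_int_poly_eq_0_iff)
  \<comment> \<open>Solves \<alpha> = (A \<tau> + A')/(B \<tau> + B'), that is, \<epsilon> =
    \<delta>/(B (B \<tau> + B')).\<close>
  define \<tau> where "\<tau> = ?\<psi> \<delta> / (?\<psi> b * ?\<psi> b * \<epsilon>) - ?\<psi> b' / ?\<psi> b"
  have "fls_subdegree (?\<psi> \<delta> / (?\<psi> b * ?\<psi> b * \<epsilon>)) = 2 * int (degree b) - fls_subdegree \<epsilon>"
    using b \<epsilon>(1) \<delta> by (simp add: fls_divide_subdegree fls_subdegree_fls_of_int_poly)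
  moreover have "fls_subdegree (?\<psi> b' / ?\<psi> b) \<ge> 0"
  proof (cases "b' = 0")
    case False
    with b deg(3) show ?thesis
      by (subst fls_divide_subdegree) (auto simp: fls_of_int_poly_eq_0_iff fls_subdegree_fls_of_int_poly)
  qed (simp add: fls_of_int_poly_simps)
  ultimately have \<tau>: "fls_subdegree \<tau> < 0"
    unfolding \<tau>_def using \<epsilon> b \<delta> by (subst fls_subdegree_diff_eq1) auto
  have eq: "?\<psi> b * \<tau> + ?\<psi> b' = ?\<psi> \<delta> / (?\<psi> b * \<epsilon>)"
    using b \<epsilon>(1) by (simp add: \<tau>_def field_simps)
  have nz: "?\<psi> b * \<tau> + ?\<psi> b' \<noteq> 0" unfolding eq using b \<delta> \<epsilon>(1) by simp
  have "?\<psi> b * (?\<psi> (b + c) * \<tau> + ?\<psi> (b' + c')) = ?\<psi> (b + c) * (?\<psi> b * \<tau> + ?\<psi> b') + ?\<psi> \<delta>"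
    by (simp add: \<delta>_def fls_of_int_poly_simps algebra_simps)
  also have "?\<psi> \<delta> = ?\<psi> b * \<epsilon> * (?\<psi> b * \<tau> + ?\<psi> b')"
    using eq b \<epsilon>(1) by (simp add: field_simps)
  also have "?\<psi> (b + c) * (?\<psi> b * \<tau> + ?\<psi> b') + \<dots> = ?\<psi> b * (\<alpha> * (?\<psi> b * \<tau> + ?\<psi> b'))"
    using b by (simp add: \<epsilon>_def field_simps)
  finally have "?\<psi> (b + c) * \<tau> + ?\<psi> (b' + c') = \<alpha> * (?\<psi> b * \<tau> + ?\<psi> b')" using b by simp
  hence "\<alpha> = ?\<psi> 1 + (?\<psi> c * \<tau> + ?\<psi> c') / (?\<psi> b * \<tau> + ?\<psi> b')"
    using nz by (simp add: field_simps fls_of_int_poly_simps)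
  hence \<alpha>: "\<alpha> = ?\<psi> 1 + 1 / ((?\<psi> b * \<tau> + ?\<psi> b') / (?\<psi> c * \<tau> + ?\<psi> c'))" by simp
  \<comment> \<open>Only the order of \<tau> is known, so it contributes no quotient; the leading 1
    accounts for \<open>Suc m\<close>.\<close>
  have "specializable_upto 0 \<tau>" by (simp add: specializable_upto_def)
  from cf_mat_specializable_upto[OF M \<tau> this] have "specializable_upto (Suc m) \<alpha>"
    by (subst \<alpha>, unfold fls_of_int_poly_def[of 1], intro specializable_upto_step) simp_all
  thus ?thesis by (simp add: specializable_upto_def)
qed

text \<open>Consecutive partial products differ by P_n / h(n + 1), whose order strictly increases
  with n. So they converge, and the first omitted term alone fixes the order of the error.\<close>

lemma fls_has_prod_one_plus_inverse:
  fixes h :: "nat \<Rightarrow> 'a :: field fls"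
  assumes h0: "fls_subdegree (h 0) < 0"
    and dec: "\<And>n. fls_subdegree (h (Suc n)) < fls_subdegree (h n)"
  obtains \<alpha> where "(\<lambda>i. 1 + 1 / h i) has_prod \<alpha>"
    and "\<And>n. \<alpha> - (\<Prod>i\<le>n. 1 + 1 / h i) \<noteq> 0"
    and "\<And>n. fls_subdegree (\<alpha> - (\<Prod>i\<le>n. 1 + 1 / h i)) = - fls_subdegree (h (Suc n))"
proof -
  define P where "P = (\<lambda>n. \<Prod>i\<le>n. 1 + 1 / h i)"
  define d where "d = (\<lambda>n. - fls_subdegree (h (Suc n)))"
  have neg: "fls_subdegree (h n) < - int n" for n
  proof (induction n)
    case (Suc n)
    with dec[of n] show ?case by linarith
  qed (use h0 in simp)
  have hnz: "h n \<noteq> 0" for n using neg[of n] by auto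
  have d_gt: "d n > int n" for n using neg[of "Suc n"] by (simp add: d_def)
  have d_less: "d m < d n" if "m < n" for m n
    using that by (rule lift_Suc_mono_less[of d, rotated]) (simp add: d_def dec)
  have fac: "1 + 1 / h n \<noteq> 0 \<and> fls_subdegree (1 + 1 / h n) = 0" for n
  proof -
    have "fls_subdegree (1 / h n) > 0"
      using neg[of n] by (intro fls_subdegree_inverse_pos) linarith
    hence "fls_subdegree (1 + 1 / h n) = 0" by (subst fls_subdegree_add_eq1) auto
    moreover have "1 + 1 / h n \<noteq> 0"
    proof
      assume "1 + 1 / h n = 0"
      hence "1 / h n = - 1" by (simp add: add_eq_0_iff)
      with \<open>fls_subdegree (1 / h n) > 0\<close> show False by simp
    qed
    ultimately show ?thesis by blast
  qed
  have P0: "P n \<noteq> 0" "fls_subdegree (P n) = 0" for n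
    unfolding P_def by (induction n) (simp_all add: fac)
  have P_Suc: "P (Suc n) = P n + P n / h (Suc n)" for n
    by (simp add: P_def algebra_simps)
  have diff: "P (n + Suc k) - P n \<noteq> 0 \<and> fls_subdegree (P (n + Suc k) - P n) = d n" for n k
  proof (induction k)
    case 0
    show ?case using P0 hnz[of "Suc n"]
      by (simp add: P_Suc fls_divide_subdegree d_def)
  next
    case (Suc k)
    have "P (n + Suc (Suc k)) - P n = (P (n + Suc k) - P n) + P (n + Suc k) / h (Suc (n + Suc k))"
      using P_Suc[of "n + Suc k"] by simp
    moreover have "fls_subdegree (P (n + Suc k) / h (Suc (n + Suc k))) = d (n + Suc k)"
      using P0 hnz by (simp add: fls_divide_subdegree d_def)
    moreover have "d n < d (n + Suc k)" by (rule d_less) simp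
    ultimately have *: "fls_subdegree (P (n + Suc (Suc k)) - P n) = d n"
      using Suc.IH by (metis fls_subdegree_add_eq1)
    moreover have "d n > 0" using d_gt[of n] by linarith
    ultimately show ?case by auto
  qed
  \<comment> \<open>The diagonal limit: since \<open>d k > k\<close>, coefficient k no longer
    changes after P_k.\<close>
  define \<alpha> where "\<alpha> = fps_to_fls (Abs_fps (\<lambda>k. P k $$ int k))"
  have \<alpha>_nth: "\<alpha> $$ j = P n $$ j" if "j \<le> int n" for j n
  proof (cases "j \<ge> 0")
    case True
    then obtain k where k: "j = int k" using nonneg_int_cases by blast
    have "P k $$ j = P n $$ j"
    proof (cases "n = k")
      case False
      with that k obtain l where l: "n = k + Suc l" using less_iff_Suc_add[of k n] by auto
      have "(P n - P k) $$ j = 0"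
        unfolding l using diff[of k l] d_gt[of k] k by (intro fls_eq0_below_subdegree) simp
      thus ?thesis by simp
    qed simp
    thus ?thesis by (simp add: \<alpha>_def k)
  next
    case False
    with P0(2)[of n] show ?thesis by (simp add: \<alpha>_def)
  qed
  have \<alpha>_sub: "fls_subdegree (\<alpha> - P n) = d n \<and> \<alpha> - P n \<noteq> 0" for n
  proof -
    \<comment> \<open>For each j, a late enough partial product shares its j-th coefficient with
      \<alpha>.\<close>
    have eq: "(\<alpha> - P n) $$ j = (P (n + Suc (nat j)) - P n) $$ j" for j
      using \<alpha>_nth[of j "n + Suc (nat j)"] by simp
    have "fls_subdegree (\<alpha> - P n) = d n"
    proof (rule fls_subdegree_eqI)
      show "(\<alpha> - P n) $$ d n \<noteq> 0"
        unfolding eq using diff[of n "nat (d n)"] by (metis nth_fls_subdegree_nonzero)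
      show "(\<alpha> - P n) $$ j = 0" if "j < d n" for j
        unfolding eq using diff[of n "nat j"] that by (intro fls_eq0_below_subdegree) simp
    qed
    moreover have "d n > 0" using d_gt[of n] by linarith
    ultimately show ?thesis by auto
  qed
  have "dist (P n) \<alpha> \<le> (1 / 2) ^ n" for n
  proof -
    have "dist (P n) \<alpha> = inverse (2 ^ nat (d n))"
      using \<alpha>_sub[of n] d_gt[of n] by (auto simp: dist_fls_def fls_subdegree_minus_sym[of \<alpha>])
    also have "\<dots> \<le> inverse (2 ^ n)"
      using d_gt[of n] by (intro le_imp_inverse_le power_increasing) auto
    finally show ?thesis by (simp add: field_simps)
  qed
  hence "(\<lambda>n. dist (P n) \<alpha>) \<longlonglongrightarrow> 0"
    by (intro tendsto_sandwich[OF _ _ tendsto_const LIMSEQ_power_zero[of "1 / 2 :: real"]]) auto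
  hence "P \<longlonglongrightarrow> \<alpha>" by (subst tendsto_dist_iff)
  \<comment> \<open>\<open>has_prod\<close> demands a nonzero limit; a zero one would give \<alpha>
    - P_0 order 0.\<close>
  moreover have "\<alpha> \<noteq> 0"
  proof
    assume "\<alpha> = 0"
    with \<alpha>_sub[of 0] P0(2)[of 0] d_gt[of 0] show False by simp
  qed
  ultimately have "(\<lambda>i. 1 + 1 / h i) has_prod \<alpha>"
    by (simp add: has_prod_def raw_has_prod_def P_def)
  thus ?thesis using that \<alpha>_sub by (simp add: P_def d_def)
qed

text \<open>The error of P_n has order deg f_(n+1) > deg AB = 2 deg B, so the criterion covers m > n
  partial quotients, and n is arbitrary.\<close>

lemma specializable_S_inf:
  assumes f: "degree f > 1" and st: "\<And>n. \<exists>b b' c c'. cf_state f n b b' c c'"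
  shows "specializable (S_inf f)"
proof -
  define h where "h = (\<lambda>i. fls_of_int_poly (poly_iter f i))"
  have sub: "fls_subdegree (h i) = - int (degree f ^ i)" for i
    by (simp add: h_def fls_subdegree_fls_of_int_poly degree_poly_iter)
  have "fls_subdegree (h 0) < 0" by (simp add: sub)
  moreover have "fls_subdegree (h (Suc n)) < fls_subdegree (h n)" for n
    unfolding sub using f by simp
  ultimately obtain \<alpha> where \<alpha>: "(\<lambda>i. 1 + 1 / h i) has_prod \<alpha>"
    "\<And>n. \<alpha> - (\<Prod>i\<le>n. 1 + 1 / h i) \<noteq> 0"
    "\<And>n. fls_subdegree (\<alpha> - (\<Prod>i\<le>n. 1 + 1 / h i)) = - fls_subdegree (h (Suc n))"
    by (rule fls_has_prod_one_plus_inverse) blast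
  have hnz: "h i \<noteq> 0" for i
    using sub[of i] f by auto
  have "specializable_upto n \<alpha>" for n
  proof -
    obtain b b' c c' m where m: "m > n" "cf_mat m b b' c c'"
      and P: "(b + c) * (\<Prod>i\<le>n. poly_iter f i) = b * (\<Prod>i\<le>n. poly_iter f i + 1)"
      and deg: "degree ((b + c) * b) < degree (poly_iter f (Suc n))"
      using st[of n] unfolding cf_state_def by blast
    note M = cf_mat_degree[OF m(2)]
    have "fls_of_int_poly ((b + c) * (\<Prod>i\<le>n. poly_iter f i)) = fls_of_int_poly (b * (\<Prod>i\<le>n. poly_iter f i + 1))"
      by (simp only: P)
    hence "(\<Prod>i\<le>n. 1 + 1 / h i) = fls_of_int_poly (b + c) / fls_of_int_poly b"
      using M(1) hnz
      by (intro prod_one_plus_inverse)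
         (simp_all add: h_def fls_of_int_poly_prod fls_of_int_poly_simps fls_of_int_poly_eq_0_iff)
    moreover have "degree ((b + c) * b) = 2 * degree b" using M by (simp add: degree_mult_eq)
    ultimately have "specializable_upto m \<alpha>"
      using \<alpha>(2,3)[of n] deg
      by (intro cf_mat_specializable_upto_approx[OF m(2)])
         (simp_all add: h_def fls_subdegree_fls_of_int_poly)
    thus ?thesis using m(1) by (simp add: specializable_upto_def)
  qed
  hence "specializable (cfrac_of_fls \<alpha>)" by (simp add: specializable_iff_upto)
  moreover have "S_inf f = cfrac_of_fls \<alpha>"
    using has_prod_unique[OF \<alpha>(1)] by (simp add: S_inf_def h_def fls_of_int_poly_def)
  ultimately show ?thesis by simp
qed

theorem theorem3p1:
  fixes f G g :: "int poly"
  defines "x \<equiv> [:0, 1:]"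
  assumes "f \<noteq> 0" and "G \<noteq> 0" and "g \<noteq> 0"
    and "degree f \<ge> 3"
    and "f = x^2 * (x + 1) * g
       \<or> f = x * (x + 1) * G - x - 1
       \<or> f = x * (x + 1)^2 * g - 1
       \<or> f = x * (x + 1) * ((x - 1) * g + 2) - 2 * x - 1
       \<or> f = x * (x + 1) * ((x + 2) * g - 2) - 2 * x - 2
       \<or> f = x * (x + 1) * (x * (x - 1) * g + 1) - x
       \<or> f = x * (x + 1) * ((x + 2) * (x + 1) * g - 1) - x - 2"
  shows "(\<forall>n. specializable (S_fin f n)) \<and> specializable (S_inf f)"
proof -
  have st: "\<exists>b b' c c'. cf_state f n b b' c c'" for n
    using assms(6) unfolding x_def
    by (elim disjE) (intro cf_state_form_i cf_state_form_ii cf_state_form_iii cf_state_form_iv cf_state_form_v cf_state_form_vi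
        cf_state_form_vii \<open>degree f \<ge> 3\<close>; assumption)+
  moreover have "degree f > 1" using \<open>degree f \<ge> 3\<close> by simp
  ultimately show ?thesis
    using specializable_S_fin[of f] specializable_S_inf[of f]
    by (metis less_trans zero_less_one)
qed

end
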